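(* Let $l\ge 3$ be an integer and let $G$ be a graph. Then $G$ is $l$-colorable if and only if $T_{l-2}(G,+)$ admits a homomorphism to $C_{-l}$. Moreover, $G$ is $(l+1)$-critical if and only if $T_{l-2}(G,+)$ is $C_{-l}$-critical.
   Context: All graphs are finite and simple. A signed graph $(G,\sigma)$ is a graph $G$ with a signature $\sigma:E(G)\to\{+,-\}$; $(G,+)$ denotes $G$ with all edges positive. The sign of a walk is the product of the signs of its edges, counted with multiplicity. Switching at a set $X\subseteq V(G)$ means flipping the signs of all edges with exactly one end in $X$; two signatures on $G$ are equivalent if one is obtained from the other by switching. A homomorphism $(G,\sigma)\to(H,\pi)$ exists if and only if there are a signature $\sigma'$ equivalent to $\sigma$ and a map $f:V(G)\to V(H)$ such that for every edge $uv$ of $G$, $f(u)f(v)$ is an edge of $H$ with $\pi(f(u)f(v))=\sigma'(uv)$. A subgraph of $(G,\sigma)$ is a subgraph of $G$ with the restricted signature. $C_{-l}$ denotes a signed cycle of length $l$ with an odd number of negative edges (unique up to switching). For a positive integer $m$ and a signed graph $(G,\sigma)$, $T_m(G,\sigma)$ is the signed graph obtained by replacing each edge $uv$ of $G$ by a $u$–$v$ path of length $m$ (with new internal vertices) whose edges are given signs so that the sign of the path is $-\sigma(uv)$ (this is well defined up to switching). For $ij\in\mathbb{Z}_2^2$, $g_{ij}(G,\sigma)$ is the length of a shortest closed walk whose number of negative edges is congruent to $i$ modulo 2 and whose length is congruent to $j$ modulo 2 ($\infty$ if none exists). A signed graph $(G,\sigma)$ is $(H,\pi)$-critical if: $g_{ij}(G,\sigma)\ge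 g_{ij}(H,\pi)$ for each $ij\in\mathbb{Z}_2^2$; $(G,\sigma)$ admits no homomorphism to $(H,\pi)$; and every proper subgraph of $(G,\sigma)$ admits a homomorphism to $(H,\pi)$. A graph is $k$-critical if its chromatic number is $k$ and all its proper subgraphs are $(k-1)$-colorable. *)

theory Defs
  imports Main "HOL-Library.Extended_Nat"
begin

type_synonym 'a graph = "'a set \<times> 'a set set"

abbreviation verts :: "'a graph \<Rightarrow> 'a set" where "verts G \<equiv> fst G"
abbreviation edges :: "'a graph \<Rightarrow> 'a set set" where "edges G \<equiv> snd G"

definition simple_graph :: "'a graph \<Rightarrow> bool" where
  "simple_graph G \<longleftrightarrow> finite (verts G) \<and> (\<forall>e\<in>edges G. e \<subseteq> verts G \<and> card e = 2)"

definition subgraph :: "'a graph \<Rightarrow> 'a graph \<Rightarrow> bool" where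
  "subgraph H G \<longleftrightarrow> simple_graph H \<and> verts H \<subseteq> verts G \<and> edges H \<subseteq> edges G"

definition proper_subgraph :: "'a graph \<Rightarrow> 'a graph \<Rightarrow> bool" where
  "proper_subgraph H G \<longleftrightarrow> subgraph H G \<and> H \<noteq> G"

definition colorable :: "nat \<Rightarrow> 'a graph \<Rightarrow> bool" where
  "colorable k G \<longleftrightarrow>
     (\<exists>c :: 'a \<Rightarrow> nat. (\<forall>v\<in>verts G. c v < k) \<and> (\<forall>u v. {u, v} \<in> edges G \<longrightarrow> c u \<noteq> c v))"

definition chromatic_number :: "'a graph \<Rightarrow> nat" where
  "chromatic_number G = (LEAST k. colorable k G)"

definition color_critical :: "nat \<Rightarrow> 'a graph \<Rightarrow> bool" where
  "color_critical k G \<longleftrightarrow>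
     chromatic_number G = k \<and> (\<forall>H. proper_subgraph H G \<longrightarrow> colorable (k - 1) H)"


text \<open>A signature takes the values 1 and -1 on the edges; its values on sets that are not edges
  are irrelevant. In particular the same function serves as its own restriction to a subgraph.\<close>

type_synonym 'a signed_graph = "'a graph \<times> ('a set \<Rightarrow> int)"

definition signed_graph :: "'a signed_graph \<Rightarrow> bool" where
  "signed_graph S \<longleftrightarrow> simple_graph (fst S) \<and> (\<forall>e\<in>edges (fst S). snd S e \<in> {1, -1})"

definition all_positive :: "'a set \<Rightarrow> int" where
  "all_positive e = 1"

definition switch :: "'a set \<Rightarrow> ('a set \<Rightarrow> int) \<Rightarrow> 'a set \<Rightarrow> int" where
  "switch X \<sigma> e = (if card (e \<inter> X) = 1 then - \<sigma> e else \<sigma> e)"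

definition switching_equivalent :: "'a graph \<Rightarrow> ('a set \<Rightarrow> int) \<Rightarrow> ('a set \<Rightarrow> int) \<Rightarrow> bool" where
  "switching_equivalent G \<sigma> \<sigma>' \<longleftrightarrow>
     (\<exists>X. X \<subseteq> verts G \<and> (\<forall>e\<in>edges G. \<sigma>' e = switch X \<sigma> e))"

definition admits_hom :: "'a signed_graph \<Rightarrow> 'b signed_graph \<Rightarrow> bool" where
  "admits_hom S K \<longleftrightarrow>
     (\<exists>\<sigma>' f. switching_equivalent (fst S) (snd S) \<sigma>' \<and>
        f ` verts (fst S) \<subseteq> verts (fst K) \<and>
        (\<forall>u v. {u, v} \<in> edges (fst S) \<longrightarrow>
           {f u, f v} \<in> edges (fst K) \<and> snd K {f u, f v} = \<sigma>' {u, v}))"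


text \<open>Walks are given by their nonempty vertex sequences.\<close>

fun walk_edges :: "'a list \<Rightarrow> 'a set list" where
  "walk_edges (x # y # xs) = {x, y} # walk_edges (y # xs)"
| "walk_edges _ = []"

definition walk_sign :: "('a set \<Rightarrow> int) \<Rightarrow> 'a list \<Rightarrow> int" where
  "walk_sign \<sigma> p = prod_list (map \<sigma> (walk_edges p))"

definition closed_walk :: "'a graph \<Rightarrow> 'a list \<Rightarrow> bool" where
  "closed_walk G p \<longleftrightarrow>
     p \<noteq> [] \<and> set p \<subseteq> verts G \<and> set (walk_edges p) \<subseteq> edges G \<and> hd p = last p"

definition negative_count :: "('a set \<Rightarrow> int) \<Rightarrow> 'a list \<Rightarrow> nat" where
  "negative_count \<sigma> p = length (filter (\<lambda>e. \<sigma> e = -1) (walk_edges p))"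

text \<open>The infimum of the empty set in \<^typ>\<open>enat\<close> is infinity. The walk of length 0 is a closed
  walk; it only affects the value for \<open>i = j = 0\<close>.\<close>

definition walk_girth :: "nat \<Rightarrow> nat \<Rightarrow> 'a signed_graph \<Rightarrow> enat" where
  "walk_girth i j S =
     Inf {enat (length (walk_edges p)) | p.
       closed_walk (fst S) p \<and> negative_count (snd S) p mod 2 = i mod 2 \<and>
       length (walk_edges p) mod 2 = j mod 2}"

definition hom_critical :: "'b signed_graph \<Rightarrow> 'a signed_graph \<Rightarrow> bool" where
  "hom_critical K S \<longleftrightarrow>
     (\<forall>i\<in>{0, 1}. \<forall>j\<in>{0, 1}. walk_girth i j S \<ge> walk_girth i j K) \<and>
     \<not> admits_hom S K \<and>
     (\<forall>H. proper_subgraph H (fst S) \<longrightarrow> admits_hom (H, snd S) K)"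


definition cycle_graph :: "nat \<Rightarrow> nat graph" where
  "cycle_graph l = ({..<l}, {{i, (i + 1) mod l} | i. i < l})"

text \<open>\<open>C\<^sub>-\<^sub>l\<close> is only determined up to switching; the predicate holds for each of its
  representatives on the vertex set \<open>{..<l}\<close>.\<close>

definition is_neg_cycle :: "nat \<Rightarrow> nat signed_graph \<Rightarrow> bool" where
  "is_neg_cycle l C \<longleftrightarrow>
     signed_graph C \<and> fst C = cycle_graph l \<and> odd (card {e \<in> edges (fst C). snd C e = -1})"


text \<open>The \<open>i\<close>-th vertex of the path of length \<open>m\<close> that replaces the edge \<open>uv\<close>, counted from \<open>u\<close>.
  A new vertex is encoded by its distances to the two ends along the path, so that the
  \<open>i\<close>-th vertex from \<open>u\<close> is the \<open>(m - i)\<close>-th one from \<open>v\<close>.\<close>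

definition path_vertex :: "nat \<Rightarrow> 'a \<Rightarrow> 'a \<Rightarrow> nat \<Rightarrow> 'a + ('a \<times> nat) set" where
  "path_vertex m u v i =
     (if i = 0 then Inl u else if i = m then Inl v else Inr {(u, i), (v, m - i)})"

definition edge_path :: "nat \<Rightarrow> 'a \<Rightarrow> 'a \<Rightarrow> ('a + ('a \<times> nat) set) list" where
  "edge_path m u v = map (path_vertex m u v) [0..<Suc m]"

definition subdivision :: "nat \<Rightarrow> 'a graph \<Rightarrow> ('a + ('a \<times> nat) set) graph" where
  "subdivision m G =
     (Inl ` verts G \<union> (\<Union>{set (edge_path m u v) | u v. {u, v} \<in> edges G}),
      \<Union>{set (walk_edges (edge_path m u v)) | u v. {u, v} \<in> edges G})"

text \<open>\<open>T\<^sub>m(G, \<sigma>)\<close> is only determined up to switching; the predicate \<open>is_T m S T\<close> holds for each of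
  its representatives on the subdivided graph.\<close>

definition is_T :: "nat \<Rightarrow> 'a signed_graph \<Rightarrow> ('a + ('a \<times> nat) set) signed_graph \<Rightarrow> bool" where
  "is_T m S T \<longleftrightarrow>
     signed_graph T \<and> fst T = subdivision m (fst S) \<and>
     (\<forall>u v. {u, v} \<in> edges (fst S) \<longrightarrow> walk_sign (snd T) (edge_path m u v) = - snd S {u, v})"


text \<open>Sanity checks: the representatives exist.\<close>

lemma is_neg_cycle_exists:
  assumes "l \<ge> 3"
  shows "\<exists>C. is_neg_cycle l C"
proof -
  define \<pi> :: "nat set \<Rightarrow> int" where "\<pi> e = (if e = {0, 1} then -1 else 1)" for e
  have "i \<noteq> (i + 1) mod l \<and> (i + 1) mod l < l" if "i < l" for i
    using that assms by (cases "i + 1 = l") auto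
  then have "simple_graph (cycle_graph l)"
    unfolding simple_graph_def cycle_graph_def by (auto simp: card_2_iff)
  moreover have "{0, 1} \<in> edges (cycle_graph l)"
    unfolding cycle_graph_def using assms by (auto intro!: exI[of _ 0])
  then have "{e \<in> edges (cycle_graph l). \<pi> e = -1} = {{0, 1}}"
    by (auto simp: \<pi>_def)
  ultimately have "is_neg_cycle l (cycle_graph l, \<pi>)"
    unfolding is_neg_cycle_def signed_graph_def by (simp add: \<pi>_def)
  then show ?thesis by blast
qed

lemma walk_edges_snoc: "xs \<noteq> [] \<Longrightarrow> walk_edges (xs @ [y]) = walk_edges xs @ [{last xs, y}]"
  by (induction xs rule: walk_edges.induct) auto

lemma walk_edges_map_upt:
  "walk_edges (map f [0..<Suc m]) = map (\<lambda>i. {f i, f (Suc i)}) [0..<m]"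
proof (induction m)
  case (Suc m)
  have "walk_edges (map f [0..<Suc (Suc m)]) = walk_edges (map f [0..<Suc m] @ [f (Suc m)])"
    by simp
  also have "\<dots> = walk_edges (map f [0..<Suc m]) @ [{f m, f (Suc m)}]"
    by (subst walk_edges_snoc) auto
  finally show ?case using Suc.IH by simp
qed simp

lemma walk_edges_edge_path:
  "walk_edges (edge_path m u v) = map (\<lambda>i. {path_vertex m u v i, path_vertex m u v (Suc i)}) [0..<m]"
  unfolding edge_path_def by (rule walk_edges_map_upt)

lemma walk_sign_edge_path:
  "walk_sign \<tau> (edge_path m u v) = (\<Prod>i<m. \<tau> {path_vertex m u v i, path_vertex m u v (Suc i)})"
  unfolding walk_sign_def walk_edges_edge_path
  by (simp add: prod.distinct_set_conv_list[symmetric] comp_def atLeast0LessThan)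

lemma path_vertex_rev: "m > 0 \<Longrightarrow> i \<le> m \<Longrightarrow> path_vertex m v u i = path_vertex m u v (m - i)"
  by (auto simp: path_vertex_def)

lemma walk_sign_edge_path_rev:
  assumes "m > 0"
  shows "walk_sign \<tau> (edge_path m v u) = walk_sign \<tau> (edge_path m u v)"
proof -
  let ?g = "\<lambda>i. \<tau> {path_vertex m u v i, path_vertex m u v (Suc i)}"
  have "\<tau> {path_vertex m v u i, path_vertex m v u (Suc i)} = ?g (m - Suc i)" if "i < m" for i
    using that assms path_vertex_rev[of m i v u] path_vertex_rev[of m "Suc i" v u]
    by (simp add: Suc_diff_Suc insert_commute)
  then have "walk_sign \<tau> (edge_path m v u) = (\<Prod>i<m. ?g (m - Suc i))"
    unfolding walk_sign_edge_path by (intro prod.cong) auto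
  also have "\<dots> = walk_sign \<tau> (edge_path m u v)"
    unfolding walk_sign_edge_path by (rule prod.nat_diff_reindex)
  finally show ?thesis .
qed

lemma path_vertex_neq:
  assumes "i < m" "u \<noteq> v"
  shows "path_vertex m u v i \<noteq> path_vertex m u v (Suc i)"
  using assms by (auto simp: path_vertex_def doubleton_eq_iff)

lemma simple_graph_subdivision:
  assumes "simple_graph G"
  shows "simple_graph (subdivision m G)"
proof -
  have fin: "finite (verts G)" and e: "\<And>u v. {u, v} \<in> edges G \<Longrightarrow> u \<in> verts G \<and> v \<in> verts G \<and> u \<noteq> v"
    using assms by (fastforce simp: simple_graph_def)+
  have "{set (edge_path m u v) | u v. {u, v} \<in> edges G}
      \<subseteq> (\<lambda>(u, v). set (edge_path m u v)) ` (verts G \<times> verts G)"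
    using e by fast
  then have "finite {set (edge_path m u v) | u v. {u, v} \<in> edges G}"
    using fin by (meson finite_SigmaI finite_imageI finite_subset)
  then have "finite (verts (subdivision m G))"
    unfolding subdivision_def using fin by auto
  moreover have "a \<subseteq> verts (subdivision m G) \<and> card a = 2" if "a \<in> edges (subdivision m G)" for a
  proof -
    from that obtain u v where uv: "{u, v} \<in> edges G" "a \<in> set (walk_edges (edge_path m u v))"
      unfolding subdivision_def by auto
    then obtain i where i: "i < m" "a = {path_vertex m u v i, path_vertex m u v (Suc i)}"
      unfolding walk_edges_edge_path by auto
    have "a \<subseteq> set (edge_path m u v)"
      using i by (simp add: edge_path_def del: upt_Suc)
    moreover have "card a = 2"
      using i(2) path_vertex_neq[OF i(1), of u v] e[OF uv(1)] by simp
    moreover have "set (edge_path m u v) \<subseteq> verts (subdivision m G)"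
      unfolding subdivision_def using uv(1) by fastforce
    ultimately show ?thesis by blast
  qed
  ultimately show ?thesis by (simp add: simple_graph_def)
qed

lemma is_T_exists:
  assumes "signed_graph S" "m > 0"
  shows "\<exists>T. is_T m S T"
proof -
  obtain G \<sigma> where S: "S = (G, \<sigma>)" by fastforce
  have G: "simple_graph G" and \<sigma>: "\<And>e. e \<in> edges G \<Longrightarrow> \<sigma> e \<in> {1, -1}"
    using assms(1) by (auto simp: S signed_graph_def)
  have neq: "u \<noteq> v" if "{u, v} \<in> edges G" for u v
    using that G by (auto simp: simple_graph_def dest!: bspec)
  define pick where "pick e = (SOME u. u \<in> e)" for e :: "'a set"
  have pick: "pick {u, v} = u \<or> pick {u, v} = v" for u v
    unfolding pick_def using someI[of "\<lambda>x. x \<in> {u, v}" u] by auto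
  let ?p = "path_vertex m"
  define \<tau> :: "('a + ('a \<times> nat) set) set \<Rightarrow> int" where
    "\<tau> a = (if \<exists>u v. {u, v} \<in> edges G \<and> pick {u, v} = u \<and> \<sigma> {u, v} = 1 \<and> a = {?p u v 0, ?p u v 1}
            then -1 else 1)" for a
  have inj: "i = 0 \<and> u' = u \<and> v' = v"
    if "{u, v} \<in> edges G" "pick {u, v} = u" "{u', v'} \<in> edges G" "pick {u', v'} = u'" "i < m"
      and eq: "{?p u v i, ?p u v (Suc i)} = {?p u' v' 0, ?p u' v' 1}" for u v u' v' i
  proof (cases "m = 1")
    case True
    then show ?thesis
      using that by (auto simp: path_vertex_def doubleton_eq_iff insert_commute)
  next
    case False
    have "\<not> (u' = v \<and> v' = u)"
      using that neq[of u v] by (auto simp: insert_commute)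
    then show ?thesis
      using that False neq[of u v] neq[of u' v']
      by (auto simp: path_vertex_def doubleton_eq_iff split: if_splits)
  qed
  have sign: "walk_sign \<tau> (edge_path m u v) = - \<sigma> {u, v}"
    if uv: "{u, v} \<in> edges G" "pick {u, v} = u" for u v
  proof -
    have "\<tau> {?p u v i, ?p u v (Suc i)} = (if i = 0 then - \<sigma> {u, v} else 1)" if "i < m" for i
    proof (cases "i = 0 \<and> \<sigma> {u, v} = 1")
      case True
      then have "\<tau> {?p u v i, ?p u v (Suc i)} = -1"
        unfolding \<tau>_def using uv by auto
      then show ?thesis using True by simp
    next
      case False
      then have "\<not> (\<exists>u' v'. {u', v'} \<in> edges G \<and> pick {u', v'} = u' \<and> \<sigma> {u', v'} = 1 \<and>
          {?p u v i, ?p u v (Suc i)} = {?p u' v' 0, ?p u' v' 1})"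
        using inj[OF uv _ _ that] by blast
      then have "\<tau> {?p u v i, ?p u v (Suc i)} = 1"
        unfolding \<tau>_def by (rule if_not_P)
      then show ?thesis using False \<sigma>[OF uv(1)] by auto
    qed
    then have "walk_sign \<tau> (edge_path m u v) = (\<Prod>i<m. if i = 0 then - \<sigma> {u, v} else 1)"
      unfolding walk_sign_edge_path by (intro prod.cong) auto
    then show ?thesis using assms(2) by (simp add: prod.delta)
  qed
  have "walk_sign \<tau> (edge_path m u v) = - \<sigma> {u, v}" if "{u, v} \<in> edges G" for u v
    using pick[of u v] sign[of u v] sign[of v u] that walk_sign_edge_path_rev[OF assms(2), of \<tau> u v]
    by (auto simp: insert_commute)
  then have "is_T m S (subdivision m G, \<tau>)"
    unfolding is_T_def signed_graph_def S using simple_graph_subdivision[OF G]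
    by (simp add: \<tau>_def)
  then show ?thesis by blast
qed

end

theory Submission
  imports Defs
begin

text \<open>A homomorphism to \<open>C\<^sub>-\<^sub>l\<close> is the same as a map \<open>g\<close> to the integers modulo \<open>2 l\<close> (the cyclic double
  cover of \<open>C\<^sub>-\<^sub>l\<close>, on which switching is translation by \<open>l\<close>) that moves by \<open>\<plusminus>1\<close> along positive edges and
  by \<open>l \<plusminus> 1\<close> along negative ones. A path of length \<open>l - 2\<close> with an odd number of negative edges moves
  \<open>g\<close> by \<open>l + s\<close> with \<open>\<bar>s\<bar> \<le> l - 2\<close> and \<open>s \<equiv> l\<close> modulo 2, that is, by an arbitrary nonzero even
  residue. Hence a colour \<open>c\<close> corresponds to the even residue \<open>2 c\<close>, and a subdivided edge that misses
  at least one of its path edges imposes no constraint at all.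

  For the girth condition, the same kind of map modulo 2 shows that every closed walk of
  \<open>T\<^sub>l\<^sub>-\<^sub>2(G, +)\<close> has \<open>n\<close> negative edges and length congruent to \<open>l n\<close> modulo 2, as in \<open>C\<^sub>-\<^sub>l\<close>. A closed
  walk shorter than \<open>l\<close> covers at most one subdivided edge completely, so its edges map to
  \<open>C\<^sub>-\<^sub>l\<close>; being too short to wind around, it has an even number of negative edges.\<close>

section \<open>Lifts and their displacement along walks\<close>

definition neg_indicator :: "('a set \<Rightarrow> int) \<Rightarrow> 'a set \<Rightarrow> int" where
  "neg_indicator \<sigma> e = (if \<sigma> e = -1 then 1 else 0)"

text \<open>The modulus is a parameter because two values occur: \<open>2 * l\<close> for
  homomorphisms to the negative cycle, and 2 for the parity of closed walks.\<close>

definition lift_step :: "int \<Rightarrow> int \<Rightarrow> int \<Rightarrow> int \<Rightarrow> int \<Rightarrow> bool" where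
  "lift_step M l n a b \<longleftrightarrow> (\<exists>\<epsilon>\<in>{1, -1}. M dvd b - a - \<epsilon> - l * n)"

definition is_lift :: "int \<Rightarrow> int \<Rightarrow> 'a set set \<Rightarrow> ('a set \<Rightarrow> int) \<Rightarrow> ('a \<Rightarrow> int) \<Rightarrow> bool" where
  "is_lift M l E \<sigma> g \<longleftrightarrow>
     (\<forall>x y. {x, y} \<in> E \<longrightarrow> lift_step M l (neg_indicator \<sigma> {x, y}) (g x) (g y))"

text \<open>Reversal turns \<open>\<epsilon>\<close> into its negative and \<open>l * n\<close> into
  \<open>- l * n\<close>; the latter two differ by \<open>2 * l * n\<close>, which \<open>M\<close>
  divides. This makes the condition meaningful on undirected edges.\<close>

lemma lift_step_sym:
  assumes "M dvd 2 * l" "lift_step M l n a b"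
  shows "lift_step M l n b a"
proof -
  obtain e where e: "e \<in> {1, -1}" "M dvd b - a - e - l * n"
    using assms(2) unfolding lift_step_def by blast
  have "M dvd - (b - a - e - l * n) - 2 * l * n"
    using e(2) assms(1) by (meson dvd_diff dvd_minus_iff dvd_mult2)
  also have "- (b - a - e - l * n) - 2 * l * n = a - b - (- e) - l * n"
    by (simp add: algebra_simps)
  finally have "M dvd a - b - (- e) - l * n" .
  moreover have "- e \<in> {1, -1}" using e(1) by auto
  ultimately show ?thesis unfolding lift_step_def by blast
qed

text \<open>\<open>s\<close> is the sum of the signs \<open>\<epsilon>\<close> met along the walk,
  so it has the parity of the length and is bounded by it; each negative edge adds a further
  \<open>l\<close>. On closed walks the values of \<open>g\<close> cancel, which leaves a relation
  between length and number of negative edges.\<close>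

lemma lift_walk:
  assumes "is_lift M l E \<sigma> g" "p \<noteq> []" "set (walk_edges p) \<subseteq> E"
  shows "\<exists>s. \<bar>s\<bar> \<le> int (length (walk_edges p)) \<and> even (s - int (length (walk_edges p))) \<and>
    M dvd g (last p) - g (hd p) - s - l * int (negative_count \<sigma> p)"
  using assms(2,3)
proof (induction p rule: walk_edges.induct)
  case (1 x y xs)
  then obtain s where s: "\<bar>s\<bar> \<le> int (length (walk_edges (y # xs)))"
      "even (s - int (length (walk_edges (y # xs))))"
      "M dvd g (last (y # xs)) - g y - s - l * int (negative_count \<sigma> (y # xs))"
    by auto
  have "lift_step M l (neg_indicator \<sigma> {x, y}) (g x) (g y)"
    using assms(1) 1(3) unfolding is_lift_def by auto
  then obtain e where e: "e \<in> {1, -1}" "M dvd g y - g x - e - l * neg_indicator \<sigma> {x, y}"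
    unfolding lift_step_def by blast
  have n: "int (negative_count \<sigma> (x # y # xs)) =
      neg_indicator \<sigma> {x, y} + int (negative_count \<sigma> (y # xs))"
    by (simp add: negative_count_def neg_indicator_def)
  have "M dvd (g (last (y # xs)) - g y - s - l * int (negative_count \<sigma> (y # xs)))
      + (g y - g x - e - l * neg_indicator \<sigma> {x, y})"
    using s(3) e(2) by (rule dvd_add)
  also have "\<dots> = g (last (x # y # xs)) - g (hd (x # y # xs)) - (s + e)
      - l * int (negative_count \<sigma> (x # y # xs))"
    unfolding n by (simp add: algebra_simps)
  finally show ?case
    using s(1,2) e(1) by (intro exI[of _ "s + e"]) auto
qed (auto simp: negative_count_def)

lemma walk_sign_eq_power:
  assumes "\<And>e. e \<in> set (walk_edges p) \<Longrightarrow> \<sigma> e \<in> {1, -1}"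
  shows "walk_sign \<sigma> p = (-1) ^ negative_count \<sigma> p"
proof -
  have "(\<And>e. e \<in> set es \<Longrightarrow> \<sigma> e \<in> {1, -1}) \<Longrightarrow>
      prod_list (map \<sigma> es) = (-1) ^ length (filter (\<lambda>e. \<sigma> e = -1) es)" for es
    by (induction es) fastforce+
  then show ?thesis using assms unfolding walk_sign_def negative_count_def by blast
qed

text \<open>Only the step \<open>i0\<close> has to absorb the difference between \<open>b\<close> and the value reached.\<close>

lemma path_labelling:
  fixes n :: "nat \<Rightarrow> int"
  assumes "i0 < m" "\<And>j. \<epsilon> j \<in> {1, -1}"
  shows "\<exists>P :: nat \<Rightarrow> int. P 0 = a \<and> P m = b \<and>
    (\<forall>i<m. i \<noteq> i0 \<or> M dvd b - a - (\<Sum>j<m. \<epsilon> j + l * n j) \<longrightarrow> lift_step M l (n i) (P i) (P (Suc i)))"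
proof -
  define K where "K = b - a - (\<Sum>j<m. \<epsilon> j + l * n j)"
  define d where "d j = (\<epsilon> j + l * n j) + (if j = i0 then K else 0)" for j
  define P where "P i = a + (\<Sum>j<i. d j)" for i
  have "(\<Sum>j<m. d j) = (\<Sum>j<m. \<epsilon> j + l * n j) + K"
    unfolding d_def using assms(1) by (simp add: sum.distrib)
  then have "P m = b" by (simp add: P_def K_def)
  moreover have "lift_step M l (n i) (P i) (P (Suc i))"
    if "i \<noteq> i0 \<or> M dvd K" for i
    unfolding lift_step_def using that assms(2)
    by (intro bexI[of _ "\<epsilon> i"]) (auto simp: P_def d_def)
  ultimately show ?thesis unfolding K_def by (intro exI[of _ P]) (simp add: P_def)
qed

lemma negative_count_map_upt:
  "int (negative_count \<sigma> (map f [0..<Suc m])) = (\<Sum>i<m. neg_indicator \<sigma> {f i, f (Suc i)})"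
proof -
  have *: "int (length (filter (\<lambda>e. \<sigma> e = -1) es)) = sum_list (map (neg_indicator \<sigma>) es)" for es
    by (induction es) (auto simp: neg_indicator_def)
  show ?thesis
    unfolding negative_count_def * walk_edges_map_upt
    by (simp add: sum.distinct_set_conv_list[symmetric] comp_def atLeast0LessThan)
qed

section \<open>The negative cycle, and homomorphisms to it as lifts\<close>

text \<open>\<open>is_neg_cycle\<close> counts a set of edges, whereas going round the cycle sums
  over indices. The two agree because the \<open>l\<close> indices name distinct edges, which fails
  for \<open>l = 2\<close>.\<close>

lemma neg_cycle_odd:
  assumes "l \<ge> 3" "is_neg_cycle l C"
  shows "odd (\<Sum>i<l. neg_indicator (snd C) {i, (i + 1) mod l})"
proof -
  define e where "e i = {i, (i + 1) mod l}" for i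
  have E: "edges (fst C) = e ` {..<l}"
    using assms(2) unfolding is_neg_cycle_def cycle_graph_def e_def by auto
  have inj: "inj_on e {..<l}"
  proof (rule inj_onI)
    fix i j assume "i \<in> {..<l}" "j \<in> {..<l}" "e i = e j"
    then show "i = j" using assms(1)
      by (cases "i + 1 = l"; cases "j + 1 = l") (auto simp: e_def doubleton_eq_iff)
  qed
  have "{a \<in> edges (fst C). snd C a = -1} = e ` {i. i < l \<and> snd C (e i) = -1}"
    unfolding E by auto
  moreover have "inj_on e {i. i < l \<and> snd C (e i) = -1}"
    using inj by (rule inj_on_subset) auto
  ultimately have "card {a \<in> edges (fst C). snd C a = -1} = card {i. i < l \<and> snd C (e i) = -1}"
    by (simp only: card_image)
  moreover have "(\<Sum>i<l. neg_indicator (snd C) (e i)) = int (card {i. i < l \<and> snd C (e i) = -1})"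
  proof -
    have "(\<Sum>i<l. neg_indicator (snd C) (e i)) = (\<Sum>i\<in>{i. i < l \<and> snd C (e i) = -1}. 1)"
      unfolding neg_indicator_def by (rule sum.mono_neutral_cong_right) auto
    then show ?thesis by simp
  qed
  ultimately show ?thesis
    using assms(2) unfolding is_neg_cycle_def e_def[symmetric] by (metis even_of_nat)
qed

text \<open>Going round from 0, \<open>h\<close> grows by 1 per edge and by \<open>l\<close> more
  per negative edge. The edge back to 0 leaves the defect \<open>- l * (1 + N)\<close> with
  \<open>N\<close> the number of negative edges; \<open>N\<close> is odd, so \<open>2 * l\<close>
  divides it.\<close>

lemma neg_cycle_lift:
  assumes "l \<ge> 3" "is_neg_cycle l C"
  obtains h where "\<And>i. i < l \<Longrightarrow> int l dvd h i - int i"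
    "is_lift (2 * int l) (int l) (edges (fst C)) (snd C) h"
proof -
  define e where "e i = {i, (i + 1) mod l}" for i
  define n where "n i = neg_indicator (snd C) (e i)" for i
  define h where "h i = int i + int l * (\<Sum>j<i. n j)" for i
  have E: "edges (fst C) = e ` {..<l}"
    using assms(2) unfolding is_neg_cycle_def cycle_graph_def e_def by auto
  have odd: "odd (\<Sum>j<l. n j)"
    using neg_cycle_odd[OF assms] unfolding n_def e_def .
  have step: "lift_step (2 * int l) (int l) (n i) (h i) (h ((i + 1) mod l))" if "i < l" for i
  proof (cases "i + 1 = l")
    case False
    then have "h ((i + 1) mod l) - h i - 1 - int l * n i = 0"
      using that by (simp add: h_def algebra_simps)
    then have "2 * int l dvd h ((i + 1) mod l) - h i - 1 - int l * n i" by simp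
    then show ?thesis unfolding lift_step_def by blast
  next
    case True
    have "(\<Sum>j<l. n j) = (\<Sum>j<i. n j) + n i"
      using True by (metis Suc_eq_plus1 sum.lessThan_Suc)
    then have "h ((i + 1) mod l) - h i - 1 - int l * n i = - (int l * (1 + (\<Sum>j<l. n j)))"
      using True by (auto simp: h_def algebra_simps)
    moreover obtain k where "1 + (\<Sum>j<l. n j) = 2 * k"
      using odd by (metis dvdE odd_even_add odd_one)
    ultimately have "h ((i + 1) mod l) - h i - 1 - int l * n i = (2 * int l) * (- k)"
      by simp
    then have "2 * int l dvd h ((i + 1) mod l) - h i - 1 - int l * n i"
      by (metis dvd_triv_left)
    then show ?thesis unfolding lift_step_def by blast
  qed
  have "lift_step (2 * int l) (int l) (neg_indicator (snd C) {x, y}) (h x) (h y)"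
    if xy: "{x, y} \<in> edges (fst C)" for x y
  proof -
    obtain i where i: "i < l" "{x, y} = e i" using xy E by auto
    have "(x = i \<and> y = (i + 1) mod l) \<or> (y = i \<and> x = (i + 1) mod l)"
      using i(2) by (auto simp: e_def doubleton_eq_iff)
    then show ?thesis
      using step[OF i(1)] lift_step_sym[OF _ step[OF i(1)]] i(2) by (auto simp: n_def)
  qed
  then show ?thesis
    by (intro that[of h]) (auto simp: h_def is_lift_def)
qed

lemma switch_eq:
  assumes "x \<noteq> y"
  shows "switch X \<sigma> {x, y} = (if x \<in> X \<longleftrightarrow> y \<in> X then \<sigma> {x, y} else - \<sigma> {x, y})"
proof (cases "x \<in> X"; cases "y \<in> X")
qed (use assms in \<open>auto simp: switch_def Int_insert_left\<close>)

lemma admits_hom_imp_lift: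
  assumes "l \<ge> 3" "is_neg_cycle l C" "signed_graph (H, \<sigma>)" "admits_hom (H, \<sigma>) C"
  obtains g where "is_lift (2 * int l) (int l) (edges H) \<sigma> g"
proof -
  obtain h where h: "is_lift (2 * int l) (int l) (edges (fst C)) (snd C) h"
    using neg_cycle_lift[OF assms(1,2)] by blast
  obtain \<sigma>' f where sw: "switching_equivalent H \<sigma> \<sigma>'"
    and f: "\<And>u v. {u, v} \<in> edges H \<Longrightarrow>
        {f u, f v} \<in> edges (fst C) \<and> snd C {f u, f v} = \<sigma>' {u, v}"
    using assms(4) unfolding admits_hom_def fst_conv snd_conv by blast
  obtain X where X: "\<And>e. e \<in> edges H \<Longrightarrow> \<sigma>' e = switch X \<sigma> e"
    using sw unfolding switching_equivalent_def by blast
  define \<chi> :: "'a \<Rightarrow> int" where "\<chi> x = (if x \<in> X then 1 else 0)" for x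
  \<comment> \<open>Modulo \<open>2 * l\<close>, changing the sign of an edge is a shift by
    \<open>l\<close>. Adding \<open>l\<close> at the vertices of \<open>X\<close> shifts exactly the
    edges with one end in \<open>X\<close>, and so undoes the switching.\<close>
  define g where "g x = h (f x) + int l * \<chi> x" for x
  have "lift_step (2 * int l) (int l) (neg_indicator \<sigma> {x, y}) (g x) (g y)"
    if xy: "{x, y} \<in> edges H" for x y
  proof -
    have neq: "x \<noteq> y" and s: "\<sigma> {x, y} \<in> {1, -1}"
      using assms(3) xy by (auto simp: signed_graph_def simple_graph_def dest!: bspec)
    have "lift_step (2 * int l) (int l) (neg_indicator (snd C) {f x, f y}) (h (f x)) (h (f y))"
      using h f[OF xy] unfolding is_lift_def by blast
    then obtain e where e: "e \<in> {1, -1}"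
      "2 * int l dvd h (f y) - h (f x) - e - int l * neg_indicator (snd C) {f x, f y}"
      unfolding lift_step_def by blast
    have "snd C {f x, f y} = (if x \<in> X \<longleftrightarrow> y \<in> X then \<sigma> {x, y} else - \<sigma> {x, y})"
      using f[OF xy] X[OF xy] switch_eq[OF neq] by simp
    then have "even (\<chi> y - \<chi> x + neg_indicator (snd C) {f x, f y} - neg_indicator \<sigma> {x, y})"
      using s by (auto simp: \<chi>_def neg_indicator_def)
    then obtain k where
      "\<chi> y - \<chi> x + neg_indicator (snd C) {f x, f y} - neg_indicator \<sigma> {x, y} = 2 * k" by blast
    then have k: "int l * (\<chi> y - \<chi> x + neg_indicator (snd C) {f x, f y} - neg_indicator \<sigma> {x, y})
        = (2 * int l) * k" by simp
    have "2 * int l dvd (h (f y) - h (f x) - e - int l * neg_indicator (snd C) {f x, f y})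
        + (2 * int l) * k"
      using e(2) by simp
    also have "\<dots> = g y - g x - e - int l * neg_indicator \<sigma> {x, y}"
      unfolding k[symmetric] g_def by (simp add: algebra_simps)
    finally show ?thesis using e(1) unfolding lift_step_def by blast
  qed
  then show ?thesis by (intro that[of g]) (auto simp: is_lift_def)
qed

lemma lift_imp_admits_hom:
  assumes "l \<ge> 3" "is_neg_cycle l C" "signed_graph (H, \<sigma>)"
    and g: "is_lift (2 * int l) (int l) (edges H) \<sigma> g"
  shows "admits_hom (H, \<sigma>) C"
proof -
  obtain h where hmod: "\<And>i. i < l \<Longrightarrow> int l dvd h i - int i"
    and h: "is_lift (2 * int l) (int l) (edges (fst C)) (snd C) h"
    using neg_cycle_lift[OF assms(1,2)] by blast
  have C: "fst C = cycle_graph l" and Csgn: "\<And>e. e \<in> edges (fst C) \<Longrightarrow> snd C e \<in> {1, -1}"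
    using assms(2) unfolding is_neg_cycle_def signed_graph_def by blast+
  define f where "f x = nat (g x mod int l)" for x
  have f_less: "f x < l" for x
    using assms(1) by (simp add: f_def nat_less_iff)
  have int_f: "int (f x) = g x mod int l" for x
    using assms(1) by (simp add: f_def)
  \<comment> \<open>The values \<open>g x\<close> and \<open>h (f x)\<close> agree modulo
    \<open>l\<close>, so modulo \<open>2 * l\<close> they differ by 0 or by \<open>l\<close>. The
    vertices of the second kind are switched.\<close>
  define X where "X = {x \<in> verts H. \<not> 2 * int l dvd g x - h (f x)}"
  define \<chi> :: "'a \<Rightarrow> int" where "\<chi> x = (if x \<in> X then 1 else 0)" for x
  have \<chi>: "\<exists>k. g x = h (f x) + int l * \<chi> x + 2 * int l * k" if "x \<in> verts H" for x
  proof -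
    have "int l dvd g x - int (f x)" by (simp add: int_f)
    then have "int l dvd g x - int (f x) - (h (f x) - int (f x))"
      using hmod[OF f_less] by (rule dvd_diff)
    then have "int l dvd g x - h (f x)" by simp
    then obtain q where q: "g x - h (f x) = int l * q" by blast
    show ?thesis
    proof (cases "even q")
      case True
      then obtain k where "q = 2 * k" by blast
      then have "g x - h (f x) = 2 * int l * k" using q by simp
      moreover from this have "\<chi> x = 0" by (simp add: \<chi>_def X_def)
      ultimately show ?thesis by (intro exI[of _ k]) simp
    next
      case False
      then obtain k where k: "q = 2 * k + 1" by (elim oddE)
      have "\<not> 2 * int l dvd int l * q"
        using False assms(1) by (simp add: mult.commute[of 2])
      then have "\<chi> x = 1" using q that by (simp add: \<chi>_def X_def)
      then show ?thesis using q k by (intro exI[of _ k]) (simp add: algebra_simps)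
    qed
  qed
  \<comment> \<open>Only edges traversed in the direction with \<open>\<epsilon> = 1\<close> are
    treated here, where \<open>f\<close> moves to the next vertex of the cycle; the other direction
    follows by exchanging the ends.\<close>
  have key: "{f x, f y} \<in> edges (fst C) \<and> snd C {f x, f y} = switch X \<sigma> {x, y}"
    if xy: "{x, y} \<in> edges H"
      and up: "2 * int l dvd g y - g x - 1 - int l * neg_indicator \<sigma> {x, y}" for x y
  proof -
    have neq: "x \<noteq> y" and V: "x \<in> verts H" "y \<in> verts H" and s: "\<sigma> {x, y} \<in> {1, -1}"
      using assms(3) xy by (auto simp: signed_graph_def simple_graph_def dest!: bspec)
    obtain t where t: "g y - g x - 1 - int l * neg_indicator \<sigma> {x, y} = 2 * int l * t"
      using up by blast
    have "int (f y) = (g x + 1 + int l * (neg_indicator \<sigma> {x, y} + 2 * t)) mod int l"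
      unfolding int_f using t by (intro arg_cong[of _ _ "\<lambda>z. z mod int l"]) (simp add: algebra_simps)
    also have "\<dots> = (int (f x) + 1) mod int l"
      by (simp add: int_f mod_simps)
    also have "\<dots> = int ((f x + 1) mod l)" by (simp add: zmod_int add.commute)
    finally have fy: "f y = (f x + 1) mod l" by simp
    have E: "{f x, f y} \<in> edges (fst C)"
      unfolding C cycle_graph_def using fy f_less[of x] by auto
    obtain e where e: "e \<in> {1, -1}"
      "2 * int l dvd h (f y) - h (f x) - e - int l * neg_indicator (snd C) {f x, f y}"
      using h E unfolding is_lift_def lift_step_def by blast
    obtain r where r: "h (f y) - h (f x) - e - int l * neg_indicator (snd C) {f x, f y} = 2 * int l * r"
      using e(2) by blast
    obtain k where k: "g x = h (f x) + int l * \<chi> x + 2 * int l * k" using \<chi>[OF V(1)] by blast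
    obtain k' where k': "g y = h (f y) + int l * \<chi> y + 2 * int l * k'" using \<chi>[OF V(2)] by blast
    let ?D = "\<chi> y - \<chi> x + neg_indicator (snd C) {f x, f y} - neg_indicator \<sigma> {x, y}
        + 2 * (r + k' - k - t)"
    have eq: "1 - e = int l * ?D"
      using t r k k' by (simp add: algebra_simps)
    \<comment> \<open>\<open>h\<close> must traverse the image edge in the same direction as
      \<open>g\<close>: otherwise \<open>1 - e = 2\<close> would be a multiple of \<open>l\<close>,
      contrary to \<open>l \<ge> 3\<close>.\<close>
    have "e = 1"
    proof (rule ccontr)
      assume "e \<noteq> 1"
      then have "int l dvd 2" using eq e(1) by (auto intro: dvdI)
      then show False using assms(1) zdvd_imp_le[of "int l" 2] by simp
    qed
    \<comment> \<open>The parity of this equation says that the edge and its image have different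
      signs exactly when one end lies in \<open>X\<close>.\<close>
    then have "?D = 0" using eq assms(1) by simp
    then have "even (\<chi> y - \<chi> x + neg_indicator (snd C) {f x, f y} - neg_indicator \<sigma> {x, y})"
      by presburger
    then have "snd C {f x, f y} = (if x \<in> X \<longleftrightarrow> y \<in> X then \<sigma> {x, y} else - \<sigma> {x, y})"
      using s Csgn[OF E] by (auto simp: \<chi>_def neg_indicator_def split: if_splits)
    then show ?thesis using E switch_eq[OF neq] by simp
  qed
  have "{f x, f y} \<in> edges (fst C) \<and> snd C {f x, f y} = switch X \<sigma> {x, y}"
    if xy: "{x, y} \<in> edges H" for x y
  proof -
    obtain e where e: "e \<in> {1, -1}" "2 * int l dvd g y - g x - e - int l * neg_indicator \<sigma> {x, y}"
      using g xy unfolding is_lift_def lift_step_def by blast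
    show ?thesis
    proof (cases "e = 1")
      case True
      then show ?thesis using key[OF xy] e(2) by blast
    next
      case False
      then have e1: "e = -1" using e(1) by simp
      obtain k where k: "g y - g x - e - int l * neg_indicator \<sigma> {x, y} = 2 * int l * k"
        using e(2) by (rule dvdE)
      have c: "{y, x} = {x, y}" "{f y, f x} = {f x, f y}" by auto
      have "g x - g y - 1 - int l * neg_indicator \<sigma> {y, x}
          = - (g y - g x - e - int l * neg_indicator \<sigma> {x, y}) - 2 * int l * neg_indicator \<sigma> {x, y}"
        unfolding c e1 by simp
      also have "\<dots> = 2 * int l * (- k - neg_indicator \<sigma> {x, y})"
        unfolding k by (simp add: algebra_simps)
      finally have "2 * int l dvd g x - g y - 1 - int l * neg_indicator \<sigma> {y, x}"
        by (rule dvdI)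
      then show ?thesis using key[of y x] xy unfolding c by blast
    qed
  qed
  moreover have "switching_equivalent H \<sigma> (switch X \<sigma>)"
    unfolding switching_equivalent_def by (intro exI[of _ X]) (simp add: X_def)
  moreover have "f ` verts H \<subseteq> verts (fst C)"
    using f_less by (auto simp: C cycle_graph_def)
  ultimately show ?thesis unfolding admits_hom_def fst_conv snd_conv by blast
qed

section \<open>Labellings of the subdivided graph\<close>

lemma inj_on_path_vertex:
  assumes "u \<noteq> v"
  shows "inj_on (path_vertex m u v) {..m}"
  by (rule inj_onI) (use assms in \<open>auto simp: path_vertex_def doubleton_eq_iff split: if_splits\<close>)

lemma edges_subdivision:
  "edges (subdivision m G) = {{path_vertex m u v i, path_vertex m u v (Suc i)} | u v i. {u, v} \<in> edges G \<and> i < m}"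
  (is "_ = ?R")
proof
  show "edges (subdivision m G) \<subseteq> ?R"
    unfolding subdivision_def walk_edges_edge_path by auto blast
  show "?R \<subseteq> edges (subdivision m G)"
  proof
    fix e assume "e \<in> ?R"
    then obtain u v i where uv: "{u, v} \<in> edges G" "i < m"
      "e = {path_vertex m u v i, path_vertex m u v (Suc i)}" by blast
    then have "e \<in> set (walk_edges (edge_path m u v))"
      unfolding walk_edges_edge_path by auto
    then show "e \<in> edges (subdivision m G)" unfolding subdivision_def using uv(1) by auto
  qed
qed

text \<open>Labellings chosen path by path glue together, since different paths share only original
  vertices, where \<open>a\<close> prescribes the value. The relation \<open>R\<close> sees the edge
  itself, so it can depend on its sign or on its membership in a set.\<close>

lemma subdivision_labelling:
  fixes a :: "'a \<Rightarrow> 'b" and G :: "'a graph"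
  assumes G: "simple_graph G" and m: "m > 0"
    and sym: "\<And>e s t. R e s t \<Longrightarrow> R e t s"
    and P: "\<And>u v. {u, v} \<in> edges G \<Longrightarrow> \<exists>P. P 0 = a u \<and> P m = a v \<and>
      (\<forall>i<m. R {path_vertex m u v i, path_vertex m u v (Suc i)} (P i) (P (Suc i)))"
  obtains g where "\<And>u. g (Inl u) = a u"
    "\<And>x y. {x, y} \<in> edges (subdivision m G) \<Longrightarrow> R {x, y} (g x) (g y)"
proof -
  let ?p = "path_vertex m"
  \<comment> \<open>\<open>q\<close> is chosen per unordered edge, so it has to work for both ways
    of reading the path; symmetry of \<open>R\<close> provides the second.\<close>
  have "\<exists>q. (\<forall>w\<in>e. q (Inl w) = a w) \<and>
      (\<forall>u v i. e = {u, v} \<and> i < m \<longrightarrow> R {?p u v i, ?p u v (Suc i)} (q (?p u v i)) (q (?p u v (Suc i))))"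
    if e: "e \<in> edges G" for e
  proof -
    obtain u v where uv: "e = {u, v}" "u \<noteq> v"
      using G e by (auto simp: simple_graph_def card_2_iff)
    obtain P where P: "P 0 = a u" "P m = a v"
      "\<And>i. i < m \<Longrightarrow> R {?p u v i, ?p u v (Suc i)} (P i) (P (Suc i))"
      using P[of u v] e uv by auto
    define q where "q x = P (the_inv_into {..m} (?p u v) x)" for x
    have q: "q (?p u v i) = P i" if "i \<le> m" for i
      unfolding q_def using that the_inv_into_f_f[OF inj_on_path_vertex[OF uv(2)], of i m] by simp
    have fwd: "R {?p u v i, ?p u v (Suc i)} (q (?p u v i)) (q (?p u v (Suc i)))" if "i < m" for i
      using that P(3) q by simp
    have bwd: "R {?p v u i, ?p v u (Suc i)} (q (?p v u i)) (q (?p v u (Suc i)))" if "i < m" for i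
      using sym[OF fwd[of "m - Suc i"]] path_vertex_rev[of m i v u] path_vertex_rev[of m "Suc i" v u] that
      by (simp add: Suc_diff_Suc insert_commute)
    have "q (Inl u) = a u" "q (Inl v) = a v"
      using q[of 0] q[of m] P(1,2) m by (simp_all add: path_vertex_def)
    then show ?thesis
      using fwd bwd uv by (intro exI[of _ q]) (auto simp: doubleton_eq_iff)
  qed
  then obtain q where q: "\<And>e w. e \<in> edges G \<Longrightarrow> w \<in> e \<Longrightarrow> q e (Inl w) = a w"
    "\<And>u v i. {u, v} \<in> edges G \<Longrightarrow> i < m \<Longrightarrow>
      R {?p u v i, ?p u v (Suc i)} (q {u, v} (?p u v i)) (q {u, v} (?p u v (Suc i)))"
    by metis
  define g where "g x = (case x of Inl u \<Rightarrow> a u | Inr z \<Rightarrow> q (fst ` z) (Inr z))" for x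
  have g: "g (?p u v i) = q {u, v} (?p u v i)" if "{u, v} \<in> edges G" for u v i
    using q(1)[OF that] by (simp add: g_def path_vertex_def)
  have "R {x, y} (g x) (g y)" if e: "{x, y} \<in> edges (subdivision m G)" for x y
  proof -
    obtain u v i where uv: "{u, v} \<in> edges G" "i < m" and xy: "{x, y} = {?p u v i, ?p u v (Suc i)}"
      using e unfolding edges_subdivision by blast
    have "R {?p u v i, ?p u v (Suc i)} (g (?p u v i)) (g (?p u v (Suc i)))"
      using q(2)[OF uv] by (simp add: g[OF uv(1)])
    then show ?thesis using xy sym by (auto simp: doubleton_eq_iff insert_commute)
  qed
  then show ?thesis by (intro that[of g]) (auto simp: g_def)
qed

lemma negative_count_edge_path:
  "int (negative_count \<sigma> (edge_path m u v)) =
     (\<Sum>i<m. neg_indicator \<sigma> {path_vertex m u v i, path_vertex m u v (Suc i)})"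
  unfolding edge_path_def by (rule negative_count_map_upt)

lemma subdivision_edge_path:
  assumes "{u, v} \<in> edges G"
  shows "set (walk_edges (edge_path m u v)) \<subseteq> edges (subdivision m G)"
  using assms unfolding subdivision_def by auto

lemma odd_negative_count_edge_path:
  assumes "is_T m (G, all_positive) T" "{u, v} \<in> edges G"
  shows "odd (negative_count (snd T) (edge_path m u v))"
proof -
  have "walk_sign (snd T) (edge_path m u v) = (-1) ^ negative_count (snd T) (edge_path m u v)"
  proof (rule walk_sign_eq_power)
    fix e assume "e \<in> set (walk_edges (edge_path m u v))"
    then have "e \<in> edges (fst T)"
      using subdivision_edge_path[OF assms(2), of m] assms(1) by (auto simp: is_T_def)
    then show "snd T e \<in> {1, -1}" using assms(1) by (simp add: is_T_def signed_graph_def)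
  qed
  moreover have "walk_sign (snd T) (edge_path m u v) = -1"
    using assms by (simp add: is_T_def all_positive_def)
  ultimately show ?thesis by (metis neg_one_even_power one_neq_neg_one)
qed

lemma edge_path_ends:
  "edge_path m u v \<noteq> []" "hd (edge_path m u v) = Inl u" "m > 0 \<Longrightarrow> last (edge_path m u v) = Inl v"
  by (simp_all add: edge_path_def path_vertex_def hd_append hd_map del: upt_Suc)
     (simp add: last_map path_vertex_def)

lemma length_walk_edges_edge_path: "length (walk_edges (edge_path m u v)) = m"
  by (simp add: walk_edges_edge_path)

section \<open>Colourings of \<open>G\<close> and lifts on its subdivision\<close>

text \<open>Across a subdivided edge the lift moves by \<open>s + l\<close> modulo
  \<open>2 * l\<close>, where \<open>s + l\<close> is even and lies strictly between 0 and
  \<open>2 * l\<close>. The colour is half the residue, rounded down.\<close>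

lemma lift_imp_colorable:
  fixes G :: "'a graph"
  assumes l: "l \<ge> 3" and T: "is_T (l - 2) (G, all_positive) T"
    and g: "is_lift (2 * int l) (int l) (edges (fst T)) (snd T) g"
  shows "colorable l G"
proof -
  define r where "r u = g (Inl u) mod (2 * int l)" for u
  have r: "0 \<le> r u" "r u < 2 * int l" for u using l by (simp_all add: r_def)
  have "r u div 2 \<noteq> r v div 2" if uv: "{u, v} \<in> edges G" for u v
  proof -
    let ?p = "edge_path (l - 2) u v"
    have "set (walk_edges ?p) \<subseteq> edges (fst T)"
      using T subdivision_edge_path[OF uv] by (simp add: is_T_def)
    from lift_walk[OF g edge_path_ends(1) this]
    obtain s where s: "\<bar>s\<bar> \<le> int (l - 2)" "even (s - int (l - 2))"
        "2 * int l dvd g (Inl v) - g (Inl u) - s - int l * int (negative_count (snd T) ?p)"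
      using edge_path_ends(2,3)[of "l - 2" u v] l
      by (auto simp: length_walk_edges_edge_path)
    have "odd (int (negative_count (snd T) ?p))"
      using odd_negative_count_edge_path[OF T uv] by simp
    then obtain n where n: "int (negative_count (snd T) ?p) = 2 * n + 1" by (rule oddE)
    obtain k where "g (Inl v) - g (Inl u) - s - int l * int (negative_count (snd T) ?p) = 2 * int l * k"
      using s(3) by blast
    then have diff: "g (Inl v) - g (Inl u) = s + int l + 2 * int l * (k + n)"
      unfolding n by (simp add: algebra_simps)
    define t where "t w = g (Inl w) div (2 * int l)" for w
    have "g (Inl w) = r w + 2 * int l * t w" for w
      by (simp add: r_def t_def)
    then have q: "r v - r u = s + int l + 2 * int l * (k + n + t u - t v)"
      using diff by (simp add: algebra_simps)
    have "even (s + int l)" using s(2) l by (simp add: of_nat_diff)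
    then have "even (r v - r u)" using q by simp
    moreover have "r v \<noteq> r u"
    proof
      assume "r v = r u"
      then have "s + int l = 2 * int l * (- (k + n + t u - t v))" using q by (simp add: algebra_simps)
      then have "2 * int l dvd s + int l" by (rule dvdI)
      moreover have "0 < s + int l" "s + int l < 2 * int l" using s(1) l by auto
      ultimately show False using zdvd_imp_le[of "2 * int l" "s + int l"] by linarith
    qed
    \<comment> \<open>The residues themselves may be odd, but those of adjacent vertices have equal
      parity, so halving keeps them distinct.\<close>
    ultimately show ?thesis by presburger
  qed
  then have "nat (r u div 2) \<noteq> nat (r v div 2)" if "{u, v} \<in> edges G" for u v
    using that r(1)[of u] r(1)[of v] by (simp add: eq_nat_nat_iff)
  moreover have "nat (r u div 2) < l" for u
    using r[of u] by linarith
  ultimately show ?thesis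
    unfolding colorable_def by (intro exI[of _ "\<lambda>u. nat (r u div 2)"] conjI ballI allI impI)
qed

text \<open>The set \<open>F\<close> allows three uses: all edges of \<open>T\<close>, the edges of
  a subgraph, and the edges of a short closed walk. Only paths that lie entirely in \<open>F\<close>
  constrain \<open>c\<close>.\<close>

lemma coloring_imp_lift:
  fixes G :: "'a graph" and c :: "'a \<Rightarrow> nat"
  assumes l: "l \<ge> 3" and G: "simple_graph G" and T: "is_T (l - 2) (G, all_positive) T"
    and F: "F \<subseteq> edges (fst T)"
    and c: "\<And>u v. {u, v} \<in> edges G \<Longrightarrow> set (walk_edges (edge_path (l - 2) u v)) \<subseteq> F \<Longrightarrow>
      c u < l \<and> c v < l \<and> c u \<noteq> c v"
  shows "\<exists>g. is_lift (2 * int l) (int l) F (snd T) g"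
proof -
  define m where "m = l - 2"
  let ?p = "path_vertex m"
  let ?n = "neg_indicator (snd T)"
  \<comment> \<open>Edges outside \<open>F\<close> carry no condition, so one such edge on a path
    can absorb any discrepancy between the labels of its ends.\<close>
  define R where "R e s t \<longleftrightarrow> (e \<in> F \<longrightarrow> lift_step (2 * int l) (int l) (?n e) s t)" for e s t
  have m: "m > 0" using l by (simp add: m_def)
  have Rsym: "R e t s" if "R e s t" for e s t
    using that lift_step_sym unfolding R_def by auto
  have lab: "\<exists>P. P 0 = 2 * int (c u) \<and> P m = 2 * int (c v) \<and>
      (\<forall>i<m. R {?p u v i, ?p u v (Suc i)} (P i) (P (Suc i)))" if uv: "{u, v} \<in> edges G" for u v
  proof (cases "set (walk_edges (edge_path m u v)) \<subseteq> F")
    case False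
    then have "\<exists>i0<m. {?p u v i0, ?p u v (Suc i0)} \<notin> F"
      unfolding walk_edges_edge_path by auto
    then obtain i0 where i0: "i0 < m" "{?p u v i0, ?p u v (Suc i0)} \<notin> F" by blast
    \<comment> \<open>With \<open>i0\<close> exempt, the signs \<open>\<epsilon>\<close> can be
      chosen freely; all are taken to be 1.\<close>
    obtain P where "P 0 = 2 * int (c u)" "P m = 2 * int (c v)"
      "\<And>i. i < m \<Longrightarrow> i \<noteq> i0 \<Longrightarrow>
        lift_step (2 * int l) (int l) (?n {?p u v i, ?p u v (Suc i)}) (P i) (P (Suc i))"
      using path_labelling[OF i0(1), of "\<lambda>_. 1" "2 * int (c u)" "2 * int (c v)" "2 * int l" "int l"
        "\<lambda>i. ?n {?p u v i, ?p u v (Suc i)}"] by auto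
    then show ?thesis using i0(2) unfolding R_def by metis
  next
    case True
    then have cuv: "c u < l" "c v < l" "c u \<noteq> c v" using c[OF uv] unfolding m_def by auto
    \<comment> \<open>The path has to move by \<open>2 * k\<close> modulo \<open>2 * l\<close>. Its
      odd number of negative edges contributes \<open>l\<close>, so the signs must sum to
      \<open>2 * k - l\<close>; among \<open>l - 2\<close> signs this takes \<open>l - 1 - k\<close>
      negative ones, a number within range because \<open>1 \<le> k < l\<close>.\<close>
    define k where "k = (int (c v) - int (c u)) mod int l"
    define j where "j = nat (int l - 1 - k)"
    have "k \<noteq> 0"
    proof
      assume "k = 0"
      then have "int (c v) mod int l = int (c u) mod int l"
        unfolding k_def by (metis mod_eq_dvd_iff mod_0_imp_dvd)
      then show False using cuv by simp
    qed
    moreover have "0 \<le> k" "k < int l" unfolding k_def using l by auto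
    ultimately have j: "j \<le> m" "int j = int l - 1 - k" by (auto simp: j_def m_def)
    define \<epsilon> :: "nat \<Rightarrow> int" where "\<epsilon> i = (if i < j then -1 else 1)" for i
    let ?S = "\<Sum>i<m. ?n {?p u v i, ?p u v (Suc i)}"
    have "(\<Sum>i<m. \<epsilon> i) = (\<Sum>i<m. 1 + (if i < j then -2 else 0))"
      unfolding \<epsilon>_def by (intro sum.cong) auto
    also have "\<dots> = int m + (\<Sum>i<m. if i < j then -2 else 0)"
      by (simp add: sum.distrib)
    also have "(\<Sum>i<m. if i < j then -2 else 0) = (\<Sum>i\<in>{..<j}. -2 :: int)"
      using j(1) by (intro sum.mono_neutral_cong_right) auto
    finally have sum: "(\<Sum>i<m. \<epsilon> i) = 2 * k - int l"
      using j l by (simp add: m_def of_nat_diff)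
    have "odd (int (negative_count (snd T) (edge_path m u v)))"
      using odd_negative_count_edge_path[OF T uv] unfolding m_def by simp
    then obtain q where q: "?S = 2 * q + 1"
      unfolding negative_count_edge_path by (rule oddE)
    have "int l dvd int (c v) - int (c u) - k" unfolding k_def by simp
    then obtain t where t: "int (c v) - int (c u) - k = int l * t" by blast
    have "2 * int (c v) - 2 * int (c u) - (\<Sum>i<m. \<epsilon> i + int l * ?n {?p u v i, ?p u v (Suc i)})
        = 2 * (int (c v) - int (c u) - k) + int l - int l * ?S"
      unfolding sum.distrib sum_distrib_left[symmetric] sum by simp
    also have "\<dots> = 2 * int l * (t - q)"
      unfolding t q by (simp add: algebra_simps)
    finally have "2 * int l dvd 2 * int (c v) - 2 * int (c u)
        - (\<Sum>i<m. \<epsilon> i + int l * ?n {?p u v i, ?p u v (Suc i)})" by simp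
    moreover have "\<And>i. \<epsilon> i \<in> {1, -1}" by (simp add: \<epsilon>_def)
    ultimately obtain P where "P 0 = 2 * int (c u)" "P m = 2 * int (c v)"
      "\<And>i. i < m \<Longrightarrow> lift_step (2 * int l) (int l) (?n {?p u v i, ?p u v (Suc i)}) (P i) (P (Suc i))"
      using path_labelling[OF m, of \<epsilon> "2 * int (c u)" "2 * int (c v)" "2 * int l" "int l"
        "\<lambda>i. ?n {?p u v i, ?p u v (Suc i)}"] by auto
    then show ?thesis unfolding R_def by metis
  qed
  obtain g where "\<And>x y. {x, y} \<in> edges (subdivision m G) \<Longrightarrow> R {x, y} (g x) (g y)"
    using subdivision_labelling[OF G m Rsym lab] by metis
  then have "is_lift (2 * int l) (int l) F (snd T) g"
    using T F unfolding is_lift_def R_def is_T_def m_def by auto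
  then show ?thesis by blast
qed

section \<open>Parity of closed walks\<close>

text \<open>Each subdivided edge contributes \<open>l - 2\<close> plus an odd multiple of
  \<open>l\<close>, which is even. So a lift modulo 2 with value 0 at all original vertices exists,
  and \<open>lift_walk\<close> applied to it gives the claim.\<close>

lemma closed_walk_parity:
  fixes G :: "'a graph"
  assumes l: "l \<ge> 3" and G: "simple_graph G" and T: "is_T (l - 2) (G, all_positive) T"
    and p: "closed_walk (fst T) p"
  shows "even (length (walk_edges p) + l * negative_count (snd T) p)"
proof -
  define m where "m = l - 2"
  let ?p = "path_vertex m"
  let ?n = "neg_indicator (snd T)"
  have m: "m > 0" using l by (simp add: m_def)
  have lab: "\<exists>P :: nat \<Rightarrow> int. P 0 = 0 \<and> P m = 0 \<and>
      (\<forall>i<m. lift_step 2 (int l) (?n {?p u v i, ?p u v (Suc i)}) (P i) (P (Suc i)))"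
    if uv: "{u, v} \<in> edges G" for u v
  proof -
    let ?S = "\<Sum>i<m. ?n {?p u v i, ?p u v (Suc i)}"
    have "odd (int (negative_count (snd T) (edge_path m u v)))"
      using odd_negative_count_edge_path[OF T uv] unfolding m_def by simp
    then have "odd ?S" unfolding negative_count_edge_path .
    moreover have "(\<Sum>i<m. 1 + int l * ?n {?p u v i, ?p u v (Suc i)}) = int m + int l * ?S"
      by (simp add: sum.distrib sum_distrib_left)
    ultimately have "even (0 - 0 - (\<Sum>i<m. 1 + int l * ?n {?p u v i, ?p u v (Suc i)}))"
      using l by (simp add: m_def of_nat_diff)
    then show ?thesis
      using path_labelling[OF m, of "\<lambda>_. 1" 0 0 2 "int l" "\<lambda>i. ?n {?p u v i, ?p u v (Suc i)}"]
      by auto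
  qed
  obtain g where "\<And>x y. {x, y} \<in> edges (subdivision m G) \<Longrightarrow>
      lift_step 2 (int l) (?n {x, y}) (g x) (g y)"
    using subdivision_labelling[where R = "\<lambda>e. lift_step 2 (int l) (?n e)" and a = "\<lambda>_. 0", OF G m _ lab]
      lift_step_sym by (metis dvd_triv_left)
  then have "is_lift 2 (int l) (edges (fst T)) (snd T) g"
    using T by (auto simp: is_lift_def is_T_def m_def)
  then obtain s where "even (s - int (length (walk_edges p)))"
      "2 dvd g (last p) - g (hd p) - s - int l * int (negative_count (snd T) p)"
    using lift_walk p unfolding closed_walk_def by blast
  then have "even (int (length (walk_edges p)) + int l * int (negative_count (snd T) p))"
    using p unfolding closed_walk_def by simp
  then show ?thesis by (simp flip: of_nat_mult of_nat_add)
qed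


section \<open>Recovering \<open>G\<close> and its subgraphs from the subdivision\<close>

text \<open>For an edge of the subdivided graph this is the edge of the original graph that it comes from.\<close>

definition edge_origin :: "('a + ('a \<times> nat) set) set \<Rightarrow> 'a set" where
  "edge_origin e = (\<Union>x\<in>e. case x of Inl w \<Rightarrow> {w} | Inr z \<Rightarrow> fst ` z)"

lemma edge_origin_path:
  assumes "i < m"
  shows "edge_origin {path_vertex m u v i, path_vertex m u v (Suc i)} = {u, v}"
  using assms by (auto simp: edge_origin_def path_vertex_def)

lemma edge_origin_path_edges: "e \<in> set (walk_edges (edge_path m u v)) \<Longrightarrow> edge_origin e = {u, v}"
  unfolding walk_edges_edge_path by (auto simp: edge_origin_path)

lemma path_edges_commute:
  assumes "m > 0"
  shows "set (walk_edges (edge_path m u v)) = set (walk_edges (edge_path m v u))"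
proof -
  have "set (walk_edges (edge_path m u v)) \<subseteq> set (walk_edges (edge_path m v u))" for u v :: 'a
  proof
    fix e assume "e \<in> set (walk_edges (edge_path m u v))"
    then obtain i where i: "i < m" "e = {path_vertex m u v i, path_vertex m u v (Suc i)}"
      unfolding walk_edges_edge_path by auto
    then have "e = {path_vertex m v u (m - Suc i), path_vertex m v u (Suc (m - Suc i))}"
      using path_vertex_rev[of m i u v] path_vertex_rev[of m "Suc i" u v]
      by (simp add: Suc_diff_Suc insert_commute)
    moreover have "m - Suc i \<in> {0..<m}" using i(1) by simp
    ultimately show "e \<in> set (walk_edges (edge_path m v u))"
      unfolding walk_edges_edge_path by auto
  qed
  then show ?thesis by blast
qed

lemma card_path_edges:
  assumes "u \<noteq> v"
  shows "card (set (walk_edges (edge_path m u v))) = m"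
proof -
  have "inj_on (\<lambda>i. {path_vertex m u v i, path_vertex m u v (Suc i)}) {..<m}"
  proof (rule inj_onI)
    fix i j assume ij: "i \<in> {..<m}" "j \<in> {..<m}"
      "{path_vertex m u v i, path_vertex m u v (Suc i)} = {path_vertex m u v j, path_vertex m u v (Suc j)}"
    have eq: "a = b" if "path_vertex m u v a = path_vertex m u v b" "a \<le> m" "b \<le> m" for a b
      using inj_onD[OF inj_on_path_vertex[OF assms] that(1)] that by simp
    have "path_vertex m u v i = path_vertex m u v j \<or>
        path_vertex m u v i = path_vertex m u v (Suc j) \<and> path_vertex m u v (Suc i) = path_vertex m u v j"
      using ij(3) by (auto simp: doubleton_eq_iff)
    then show "i = j" using eq[of i j] eq[of i "Suc j"] eq[of "Suc i" j] ij(1,2) by auto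
  qed
  then show ?thesis
    unfolding walk_edges_edge_path by (simp add: card_image atLeast0LessThan)
qed

lemma simple_graph_neq: "simple_graph G \<Longrightarrow> {u, v} \<in> edges G \<Longrightarrow> u \<noteq> v"
  by (auto simp: simple_graph_def dest!: bspec)

lemma edge_origin_image:
  assumes "simple_graph G" "m > 0"
  shows "edge_origin ` edges (subdivision m G) = edges G"
proof
  show "edge_origin ` edges (subdivision m G) \<subseteq> edges G"
    unfolding edges_subdivision by (auto simp: edge_origin_path)
  show "edges G \<subseteq> edge_origin ` edges (subdivision m G)"
  proof
    fix e assume e: "e \<in> edges G"
    then obtain u v where uv: "e = {u, v}"
      using assms(1) by (auto simp: simple_graph_def card_2_iff)
    have "{path_vertex m u v 0, path_vertex m u v (Suc 0)} \<in> edges (subdivision m G)"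
      unfolding edges_subdivision using e uv assms(2) by blast
    then show "e \<in> edge_origin ` edges (subdivision m G)"
      using edge_origin_path[OF assms(2)] uv by (metis image_eqI)
  qed
qed

lemma Inl_subdivision_iff:
  assumes "simple_graph G"
  shows "Inl v \<in> verts (subdivision m G) \<longleftrightarrow> v \<in> verts G"
proof
  assume "Inl v \<in> verts (subdivision m G)"
  then consider "v \<in> verts G"
    | u w where "{u, w} \<in> edges G" "Inl v \<in> set (edge_path m u w)"
    unfolding subdivision_def by auto
  then show "v \<in> verts G"
  proof cases
    case 2
    then have "v \<in> {u, w}"
      by (auto simp: edge_path_def path_vertex_def simp del: upt_Suc split: if_splits)
    then show ?thesis using 2(1) assms by (auto simp: simple_graph_def dest!: bspec)
  qed
qed (auto simp: subdivision_def)

text \<open>Properness survives because the subdivision determines the graph: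
  \<open>edge_origin\<close> returns its edges and the \<open>Inl\<close> vertices return its
  vertices.\<close>

lemma subdivision_proper_subgraph:
  assumes "proper_subgraph H G" "simple_graph G" "m > 0"
  shows "proper_subgraph (subdivision m H) (subdivision m G)"
proof -
  have H: "simple_graph H" "verts H \<subseteq> verts G" "edges H \<subseteq> edges G" "H \<noteq> G"
    using assms(1) by (auto simp: proper_subgraph_def subgraph_def)
  have "verts (subdivision m H) \<subseteq> verts (subdivision m G)"
    "edges (subdivision m H) \<subseteq> edges (subdivision m G)"
    unfolding subdivision_def using H(2,3) by fastforce+
  moreover have "subdivision m H \<noteq> subdivision m G"
  proof
    assume "subdivision m H = subdivision m G"
    then have "edges H = edges G" "verts H = verts G"
      using edge_origin_image[OF H(1) assms(3)] edge_origin_image[OF assms(2,3)]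
        Inl_subdivision_iff[OF H(1)] Inl_subdivision_iff[OF assms(2)] by (metis, metis subsetI subset_antisym)
    then show False using H(4) by (simp add: prod_eq_iff)
  qed
  ultimately show ?thesis
    using simple_graph_subdivision[OF H(1)] by (simp add: proper_subgraph_def subgraph_def)
qed

lemma edge_path_vertex_covered:
  assumes "{u, v} \<in> edges G" "m > 0" "x \<in> set (edge_path m u v)"
  obtains e where "e \<in> edges (subdivision m G)" "x \<in> e"
proof -
  have "\<exists>i\<le>m. x = path_vertex m u v i"
    using assms(3) by (auto simp: edge_path_def less_Suc_eq_le simp del: upt_Suc)
  then obtain i where i: "i \<le> m" "x = path_vertex m u v i" by blast
  define j where "j = (if i < m then i else i - 1)"
  have "j < m" "x \<in> {path_vertex m u v j, path_vertex m u v (Suc j)}"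
    using i assms(2) by (auto simp: j_def)
  then show ?thesis using assms(1) that unfolding edges_subdivision by blast
qed

section \<open>Colourability as existence of a homomorphism\<close>

lemma coloring_imp_admits_hom:
  fixes G :: "'a graph" and c :: "'a \<Rightarrow> nat"
  assumes "l \<ge> 3" "simple_graph G" "is_T (l - 2) (G, all_positive) T" "is_neg_cycle l C"
    and H: "subgraph H (fst T)"
    and c: "\<And>u v. {u, v} \<in> edges G \<Longrightarrow> set (walk_edges (edge_path (l - 2) u v)) \<subseteq> edges H \<Longrightarrow>
      c u < l \<and> c v < l \<and> c u \<noteq> c v"
  shows "admits_hom (H, snd T) C"
proof -
  have E: "edges H \<subseteq> edges (fst T)" and "simple_graph H"
    using H by (simp_all add: subgraph_def)
  moreover have "signed_graph T" using assms(3) by (simp add: is_T_def)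
  ultimately have "signed_graph (H, snd T)" by (auto simp: signed_graph_def)
  moreover have "\<exists>g. is_lift (2 * int l) (int l) (edges H) (snd T) g"
    by (rule coloring_imp_lift[OF assms(1-3) E, where c = c]) (rule c)
  ultimately show ?thesis using lift_imp_admits_hom[OF assms(1,4)] by blast
qed

lemma colorable_iff_admits_hom:
  fixes G :: "'a graph"
  assumes "l \<ge> 3" "simple_graph G" "is_T (l - 2) (G, all_positive) T" "is_neg_cycle l C"
  shows "colorable l G \<longleftrightarrow> admits_hom T C"
proof
  have T: "signed_graph (fst T, snd T)" using assms(3) unfolding is_T_def prod.collapse by blast
  {
    assume "colorable l G"
    then obtain c where c: "\<And>v. v \<in> verts G \<Longrightarrow> c v < l" "\<And>u v. {u, v} \<in> edges G \<Longrightarrow> c u \<noteq> c v"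
      unfolding colorable_def by blast
    have "u \<in> verts G \<and> v \<in> verts G" if "{u, v} \<in> edges G" for u v
      using assms(2) that by (auto simp: simple_graph_def dest!: bspec)
    moreover have "subgraph (fst T) (fst T)"
      using T by (simp add: subgraph_def signed_graph_def)
    ultimately have "admits_hom (fst T, snd T) C"
      using c by (intro coloring_imp_admits_hom[OF assms, where c = c]) auto
    then show "admits_hom T C" by simp
  next
    assume "admits_hom T C"
    then obtain g where "is_lift (2 * int l) (int l) (edges (fst T)) (snd T) g"
      using admits_hom_imp_lift[OF assms(1,4) T] by auto
    then show "colorable l G" by (rule lift_imp_colorable[OF assms(1,3)])
  }
qed

section \<open>The girth condition\<close>

text \<open>Paths of different edges are edge-disjoint, so covering two takes
  \<open>2 * (l - 2)\<close> distinct edges. Fewer than \<open>l\<close> steps then leave only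
  \<open>l = 3\<close> and a closed walk of length 2.\<close>

lemma short_closed_walk_covers_one:
  fixes G :: "'a graph"
  assumes l: "l \<ge> 3" and G: "simple_graph G" and T: "is_T (l - 2) (G, all_positive) T"
    and p: "closed_walk (fst T) p" "length (walk_edges p) < l"
    and uv: "{u, v} \<in> edges G" "set (walk_edges (edge_path (l - 2) u v)) \<subseteq> set (walk_edges p)"
    and uv': "{u', v'} \<in> edges G" "set (walk_edges (edge_path (l - 2) u' v')) \<subseteq> set (walk_edges p)"
  shows "{u, v} = {u', v'}"
proof (rule ccontr)
  assume neq: "{u, v} \<noteq> {u', v'}"
  let ?A = "set (walk_edges (edge_path (l - 2) u v))"
  let ?B = "set (walk_edges (edge_path (l - 2) u' v'))"
  have "?A \<inter> ?B = {}"
    using neq by (metis disjoint_iff edge_origin_path_edges)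
  then have "card (?A \<union> ?B) = 2 * (l - 2)"
    using card_path_edges[OF simple_graph_neq[OF G uv(1)]] card_path_edges[OF simple_graph_neq[OF G uv'(1)]]
    by (simp add: card_Un_disjoint)
  moreover have "card (?A \<union> ?B) \<le> card (set (walk_edges p))"
    using uv(2) uv'(2) by (intro card_mono) auto
  ultimately have *: "2 * (l - 2) \<le> card (set (walk_edges p))" by simp
  then have "2 * (l - 2) \<le> length (walk_edges p)"
    using card_length[of "walk_edges p"] by linarith
  then have len: "length (walk_edges p) = 2" "l = 3" using p(2) l by linarith+
  then obtain x y z where "p = [x, y, z]"
    by (cases p rule: walk_edges.cases; cases "tl p" rule: walk_edges.cases;
        cases "tl (tl p)" rule: walk_edges.cases) auto
  \<comment> \<open>Going back and forth uses a single edge, while two paths of length 1 need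
    two.\<close>
  then have "p = [x, y, x]" using p(1) by (auto simp: closed_walk_def)
  then show False using * len(2) by (simp add: insert_commute)
qed

lemma short_closed_walk_even:
  fixes G :: "'a graph"
  assumes l: "l \<ge> 3" and G: "simple_graph G" and T: "is_T (l - 2) (G, all_positive) T"
    and p: "closed_walk (fst T) p" "length (walk_edges p) < l"
  shows "even (length (walk_edges p)) \<and> even (negative_count (snd T) p)"
proof -
  let ?F = "set (walk_edges p)"
  have F: "?F \<subseteq> edges (fst T)" using p(1) by (simp add: closed_walk_def)
  \<comment> \<open>\<open>w\<close> is one end of the covered edge, or arbitrary if none is
    covered. Colouring \<open>w\<close> differently from all other vertices then meets every
    constraint on \<open>?F\<close>.\<close>
  have "\<exists>w. \<forall>u v. {u, v} \<in> edges G \<and> set (walk_edges (edge_path (l - 2) u v)) \<subseteq> ?F \<longrightarrow> (u = w \<longleftrightarrow> v \<noteq> w)"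
  proof (cases "\<exists>u v. {u, v} \<in> edges G \<and> set (walk_edges (edge_path (l - 2) u v)) \<subseteq> ?F")
    case True
    then obtain u v where uv: "{u, v} \<in> edges G" "set (walk_edges (edge_path (l - 2) u v)) \<subseteq> ?F" by blast
    have "u' = u \<longleftrightarrow> v' \<noteq> u"
      if "{u', v'} \<in> edges G" "set (walk_edges (edge_path (l - 2) u' v')) \<subseteq> ?F" for u' v'
      using short_closed_walk_covers_one[OF l G T p uv that] simple_graph_neq[OF G uv(1)]
      by (auto simp: doubleton_eq_iff)
    then show ?thesis by blast
  qed blast
  then obtain w where w: "\<And>u v. {u, v} \<in> edges G \<Longrightarrow>
      set (walk_edges (edge_path (l - 2) u v)) \<subseteq> ?F \<Longrightarrow> (u = w \<longleftrightarrow> v \<noteq> w)" by blast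
  define c :: "'a \<Rightarrow> nat" where "c x = (if x = w then 1 else 0)" for x
  have c: "c u < l \<and> c v < l \<and> c u \<noteq> c v"
    if "{u, v} \<in> edges G" "set (walk_edges (edge_path (l - 2) u v)) \<subseteq> ?F" for u v
    using w[OF that] l by (auto simp: c_def)
  have "\<exists>g. is_lift (2 * int l) (int l) ?F (snd T) g"
    by (rule coloring_imp_lift[OF l G T F, where c = c]) (rule c)
  then obtain g where "is_lift (2 * int l) (int l) ?F (snd T) g" by blast
  from lift_walk[OF this _ subset_refl]
  obtain s where s: "\<bar>s\<bar> \<le> int (length (walk_edges p))" "even (s - int (length (walk_edges p)))"
      "2 * int l dvd g (last p) - g (hd p) - s - int l * int (negative_count (snd T) p)"
    using p(1) unfolding closed_walk_def by blast
  obtain k where "g (last p) - g (hd p) - s - int l * int (negative_count (snd T) p) = 2 * int l * k"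
    using s(3) by (rule dvdE)
  moreover have "g (last p) = g (hd p)" using p(1) by (simp add: closed_walk_def)
  ultimately have "s = - (2 * int l * k) - int l * int (negative_count (snd T) p)" by linarith
  then have k: "s = int l * (- 2 * k - int (negative_count (snd T) p))"
    by (simp add: right_diff_distrib)
  then have "int l dvd s" by (rule dvdI)
  \<comment> \<open>A multiple of \<open>l\<close> of absolute value below \<open>l\<close>
    vanishes: the walk is too short to wind around the cycle.\<close>
  then have "s = 0" using s(1) p(2) dvd_imp_le_int[of s "int l"] by fastforce
  then have "- 2 * k - int (negative_count (snd T) p) = 0" using k l by simp
  then have "even (int (negative_count (snd T) p))" by presburger
  then show ?thesis using s(2) \<open>s = 0\<close> by simp
qed

lemma walk_girth_le:
  assumes "closed_walk (fst S) p" "negative_count (snd S) p mod 2 = i mod 2"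
    "length (walk_edges p) mod 2 = j mod 2"
  shows "walk_girth i j S \<le> enat (length (walk_edges p))"
  unfolding walk_girth_def by (rule Inf_lower) (use assms in blast)

lemma walk_girth_neg_cycle_le:
  fixes G :: "'a graph"
  assumes l: "l \<ge> 3" and G: "simple_graph G" and T: "is_T (l - 2) (G, all_positive) T"
    and C: "is_neg_cycle l C"
  shows "walk_girth i j C \<le> walk_girth i j T"
proof -
  have V: "fst C = cycle_graph l" using C by (simp add: is_neg_cycle_def)
  have "walk_girth i j C \<le> enat (length (walk_edges p))"
    if p: "closed_walk (fst T) p" "negative_count (snd T) p mod 2 = i mod 2"
      "length (walk_edges p) mod 2 = j mod 2" for p
  proof (cases "even (negative_count (snd T) p)")
    case True
    then have "even (length (walk_edges p))"
      using closed_walk_parity[OF l G T p(1)] by simp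
    then have even: "even i" "even j"
      using True p(2,3) by (metis even_iff_mod_2_eq_zero)+
    \<comment> \<open>For even \<open>i\<close> and \<open>j\<close> the walk of length 0 is already
      a witness.\<close>
    have "walk_girth i j C \<le> enat (length (walk_edges [0 :: nat]))"
      using even l by (intro walk_girth_le) (auto simp: closed_walk_def V cycle_graph_def negative_count_def)
    also have "\<dots> \<le> enat (length (walk_edges p))" by simp
    finally show ?thesis .
  next
    case False
    \<comment> \<open>One turn around the cycle has the same parities as \<open>p\<close>, and
      \<open>p\<close>, having an odd number of negative edges, is no shorter than
      \<open>l\<close>.\<close>
    define q where "q = map (\<lambda>i. i mod l) [0..<Suc l]"
    have edges: "walk_edges q = map (\<lambda>i. {i mod l, Suc i mod l}) [0..<l]"
      unfolding q_def by (rule walk_edges_map_upt)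
    have "int (negative_count (snd C) q) = (\<Sum>i<l. neg_indicator (snd C) {i, (i + 1) mod l})"
      unfolding q_def negative_count_map_upt by (intro sum.cong) auto
    then have "odd (int (negative_count (snd C) q))" using neg_cycle_odd[OF l C] by simp
    then have "negative_count (snd C) q mod 2 = i mod 2"
      using False p(2) by (metis even_of_nat odd_iff_mod_2_eq_one)
    moreover have "even (length (walk_edges p) + l)"
      using closed_walk_parity[OF l G T p(1)] False by simp
    then have "l mod 2 = j mod 2"
      using p(3) by presburger
    moreover have "closed_walk (fst C) q"
      using l unfolding closed_walk_def edges V cycle_graph_def
      by (auto simp: q_def hd_map last_map simp del: upt_Suc)
    ultimately have "walk_girth i j C \<le> enat (length (walk_edges q))"
      by (intro walk_girth_le) (auto simp: edges)
    also have "\<dots> \<le> enat (length (walk_edges p))"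
      using short_closed_walk_even[OF l G T p(1)] False by (force simp: edges)
    finally show ?thesis .
  qed
  then show ?thesis unfolding walk_girth_def[of i j T] by (intro Inf_greatest) blast
qed

section \<open>Criticality\<close>

lemma colorable_mono: "colorable k G \<Longrightarrow> k \<le> k' \<Longrightarrow> colorable k' G"
  unfolding colorable_def by (meson less_le_trans)

lemma chromatic_number_eq_Suc:
  assumes "\<not> colorable k G" "colorable (Suc k) G"
  shows "chromatic_number G = Suc k"
  unfolding chromatic_number_def
proof (rule Least_equality)
  fix y assume "colorable y G"
  then show "Suc k \<le> y" using assms(1) colorable_mono[of y G k] by (meson not_less_eq_eq)
qed (rule assms(2))

text \<open>Delete a vertex, colour the rest with \<open>k\<close> colours and give the vertex the
  new colour \<open>k\<close>. This yields the upper bound on the chromatic number in the converse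
  direction.\<close>

lemma colorable_Suc_of_proper_subgraphs:
  assumes G: "simple_graph G" and "\<And>H. proper_subgraph H G \<Longrightarrow> colorable k H" "\<not> colorable k G"
  shows "colorable (Suc k) G"
proof -
  have sub: "u \<in> verts G \<and> v \<in> verts G \<and> u \<noteq> v" if "{u, v} \<in> edges G" for u v
    using G that by (auto simp: simple_graph_def dest!: bspec)
  \<comment> \<open>A vertex to delete exists, since a graph without vertices is
    \<open>k\<close>-colourable.\<close>
  have "verts G \<noteq> {}"
  proof
    assume "verts G = {}"
    then have "colorable k G" using sub unfolding colorable_def by auto
    then show False using assms(3) by simp
  qed
  then obtain w where w: "w \<in> verts G" by blast
  define H where "H = (verts G - {w}, {e \<in> edges G. w \<notin> e})"
  have "proper_subgraph H G"
    using G w by (auto simp: proper_subgraph_def subgraph_def simple_graph_def H_def prod_eq_iff)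
  then obtain c where c: "\<And>v. v \<in> verts G \<Longrightarrow> v \<noteq> w \<Longrightarrow> c v < k"
      "\<And>u v. {u, v} \<in> edges G \<Longrightarrow> u \<noteq> w \<Longrightarrow> v \<noteq> w \<Longrightarrow> c u \<noteq> c v"
    using assms(2)[of H] unfolding colorable_def H_def by auto
  show ?thesis unfolding colorable_def
  proof (intro exI[of _ "c(w := k)"] conjI ballI allI impI)
    fix v assume "v \<in> verts G"
    then show "(c(w := k)) v < Suc k" using c(1)[of v] by auto
  next
    fix u v assume "{u, v} \<in> edges G"
    then show "(c(w := k)) u \<noteq> (c(w := k)) v"
      using sub[of u v] c(1)[of u] c(1)[of v] c(2)[of u v] by auto
  qed
qed

text \<open>If \<open>H\<close> misses an edge of some path, the corresponding edge of
  \<open>G\<close> is deleted. Otherwise \<open>H\<close> keeps all edges and misses an isolated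
  vertex; inner vertices of paths are never isolated, so this is an isolated vertex of
  \<open>G\<close>, which is deleted instead.\<close>

lemma proper_subgraph_of_subdivision:
  assumes G: "simple_graph G" and m: "m > 0" and H: "proper_subgraph H (subdivision m G)"
  obtains G' where "proper_subgraph G' G"
    "\<And>u v. {u, v} \<in> edges G \<Longrightarrow> set (walk_edges (edge_path m u v)) \<subseteq> edges H \<Longrightarrow> {u, v} \<in> edges G'"
proof (cases "edges H = edges (subdivision m G)")
  case False
  then obtain u v a where uv: "{u, v} \<in> edges G" "a \<in> set (walk_edges (edge_path m u v))" "a \<notin> edges H"
    using H unfolding proper_subgraph_def subgraph_def subdivision_def by auto
  show ?thesis
  proof (rule that[of "(verts G, edges G - {{u, v}})"])
    show "proper_subgraph (verts G, edges G - {{u, v}}) G"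
      using G uv(1) by (auto simp: proper_subgraph_def subgraph_def simple_graph_def prod_eq_iff)
    fix x y assume xy: "{x, y} \<in> edges G" "set (walk_edges (edge_path m x y)) \<subseteq> edges H"
    have "{x, y} \<noteq> {u, v}"
      using xy(2) uv(2,3) path_edges_commute[OF m, of u v] by (auto simp: doubleton_eq_iff)
    then show "{x, y} \<in> edges (verts G, edges G - {{u, v}})" using xy(1) by simp
  qed
next
  case True
  have sH: "simple_graph H" and "verts H \<subseteq> verts (subdivision m G)" "H \<noteq> subdivision m G"
    using H by (auto simp: proper_subgraph_def subgraph_def)
  then have "verts H \<noteq> verts (subdivision m G)" using True by (auto simp: prod_eq_iff)
  then obtain x where x: "x \<in> verts (subdivision m G)" "x \<notin> verts H"
    using \<open>verts H \<subseteq> verts (subdivision m G)\<close> by blast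
  have "x \<notin> e" if "e \<in> edges (subdivision m G)" for e
    using sH x(2) that True unfolding simple_graph_def by blast
  then have isolated: "x \<notin> set (edge_path m u v)" if "{u, v} \<in> edges G" for u v
    using edge_path_vertex_covered[OF that m] by metis
  then obtain w where w: "w \<in> verts G" "x = Inl w"
    using x(1) unfolding subdivision_def by auto
  have "w \<noteq> u \<and> w \<noteq> v" if "{u, v} \<in> edges G" for u v
    using isolated[OF that] edge_path_ends[of m u v] m w(2) by (metis hd_in_set last_in_set)
  then have nw: "w \<notin> e" if "e \<in> edges G" for e
    using G that by (fastforce simp: simple_graph_def card_2_iff)
  show ?thesis
  proof (rule that[of "(verts G - {w}, edges G)"])
    show "proper_subgraph (verts G - {w}, edges G) G"
      using G w(1) nw by (auto simp: proper_subgraph_def subgraph_def simple_graph_def prod_eq_iff)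
  qed simp
qed

theorem lemma2p3:
  fixes l :: nat
    and G :: "'a graph"
    and T :: "('a + ('a \<times> nat) set) signed_graph"
    and C :: "nat signed_graph"
  assumes "l \<ge> 3"
    and "simple_graph G"
    and "is_T (l - 2) (G, all_positive) T"
    and "is_neg_cycle l C"
  shows "(colorable l G \<longleftrightarrow> admits_hom T C) \<and>
    (color_critical (l + 1) G \<longleftrightarrow> hom_critical C T)"
proof (intro conjI iffI)
  have m: "l - 2 > 0" using assms(1) by simp
  have T: "fst T = subdivision (l - 2) G" using assms(3) by (simp add: is_T_def)
  note iff = colorable_iff_admits_hom[OF assms]
  show "colorable l G \<Longrightarrow> admits_hom T C" "admits_hom T C \<Longrightarrow> colorable l G"
    using iff by blast+
  {
    assume crit: "color_critical (l + 1) G"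
    then have "\<not> colorable l G"
      unfolding color_critical_def chromatic_number_def by (metis less_add_one not_less_Least)
    then have "\<not> admits_hom T C" using iff by simp
    moreover have "admits_hom (H, snd T) C" if H: "proper_subgraph H (fst T)" for H
    proof -
      \<comment> \<open>\<open>G'\<close> keeps every edge of \<open>G\<close> whose whole path
        survives in \<open>H\<close>, so a colouring of \<open>G'\<close> satisfies all constraints
        that \<open>H\<close> imposes.\<close>
      obtain G' where G': "proper_subgraph G' G"
        "\<And>u v. {u, v} \<in> edges G \<Longrightarrow> set (walk_edges (edge_path (l - 2) u v)) \<subseteq> edges H \<Longrightarrow>
          {u, v} \<in> edges G'"
        using proper_subgraph_of_subdivision[OF assms(2) m] H unfolding T by blast
      have "colorable (l + 1 - 1) G'" using crit G'(1) unfolding color_critical_def by blast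
      then have "colorable l G'" by simp
      then obtain c where c: "\<And>v. v \<in> verts G' \<Longrightarrow> c v < l" "\<And>u v. {u, v} \<in> edges G' \<Longrightarrow> c u \<noteq> c v"
        unfolding colorable_def by blast
      have "u \<in> verts G' \<and> v \<in> verts G'" if "{u, v} \<in> edges G'" for u v
        using G'(1) that by (auto simp: proper_subgraph_def subgraph_def simple_graph_def dest!: bspec)
      then have "c u < l \<and> c v < l \<and> c u \<noteq> c v"
        if "{u, v} \<in> edges G" "set (walk_edges (edge_path (l - 2) u v)) \<subseteq> edges H" for u v
        using G'(2)[OF that] c by blast
      then show ?thesis
        using H by (intro coloring_imp_admits_hom[OF assms, where c = c]) (simp_all add: proper_subgraph_def)
    qed
    ultimately show "hom_critical C T"
      using walk_girth_neg_cycle_le[OF assms] unfolding hom_critical_def by blast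
  next
    assume crit: "hom_critical C T"
    then have not: "\<not> colorable l G" using iff by (simp add: hom_critical_def)
    have sub: "colorable l H" if H: "proper_subgraph H G" for H
    proof -
      have sH: "simple_graph H" and E: "edges H \<subseteq> edges G"
        using H by (simp_all add: proper_subgraph_def subgraph_def)
      have sT: "proper_subgraph (subdivision (l - 2) H) (fst T)"
        unfolding T using subdivision_proper_subgraph[OF H assms(2) m] .
      then have "edges (subdivision (l - 2) H) \<subseteq> edges (fst T)"
        by (simp add: proper_subgraph_def subgraph_def)
      \<comment> \<open>The signature of \<open>T\<close> gives the paths over \<open>H\<close> the
        required signs as well, so the first equivalence applies to \<open>H\<close> in place of
        \<open>G\<close>.\<close>
      then have "is_T (l - 2) (H, all_positive) (subdivision (l - 2) H, snd T)"
        using assms(3) simple_graph_subdivision[OF sH] E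
        unfolding is_T_def signed_graph_def fst_conv snd_conv by blast
      moreover have "admits_hom (subdivision (l - 2) H, snd T) C"
        using crit sT unfolding hom_critical_def by blast
      ultimately show ?thesis
        using colorable_iff_admits_hom[OF assms(1) sH _ assms(4)] by blast
    qed
    then show "color_critical (l + 1) G"
      using chromatic_number_eq_Suc[OF not colorable_Suc_of_proper_subgraphs[OF assms(2) sub not]]
      by (simp add: color_critical_def)
  }
qed

end
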